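(* Let $E=[0,\infty)$, let $\lambda$ be the Lebesgue measure on $[0,\infty)$, and let $b=0$. Suppose that the transition densities $(p^Z_t)_{0<t\le T}$ satisfy: (i) for all $0<t\le T$, the function $(x,y)\mapsto p^Z_t(x,y)$ is continuous on $[0,\infty)^2$; (ii) for all $x,z\in[0,\infty)$ and all $s,t>0$ with $s+t\le T$, the Kolmogorov-Chapman equation $p^Z_{s+t}(x,z)=\int_0^\infty p^Z_s(x,y)\,p^Z_t(y,z)\,dy$ holds; (iii) for all $x,y\in[0,\infty)$ and all $0\le s<t<T$, the limit $\lim_{\varepsilon\downarrow0}\frac{p^Z_{T-t}(y,\varepsilon)}{p^Z_{T-s}(x,\varepsilon)}$ exists; (iv) for all $0\le s<t<T$ and all $x\in[0,\infty)$, there is a $\delta>0$ such that $$\sup_{y\in[0,\infty)}\ \sup_{0<\varepsilon<\delta}\ \frac{p^Z_{T-t}(y,\varepsilon)}{p^Z_{T-s}(x,\varepsilon)}<\infty.$$ Let $p_{s,t}$, $0\le s<t<T$, be the functions associated with $Z$, $b=0$ and $T$ as defined in the context. Then for all $x,y\in[0,\infty)$ and $0\le s<t<T$, $$p_{s,t}(x,y)=p^Z_{t-s}(x,y)\lim_{\varepsilon\downarrow0}\frac{p^Z_{T-t}(y,\varepsilon)}{p^Z_{T-s}(x,\varepsilon)},$$ and moreover: for all $0\le s<t<T$ the function $(x,y)\mapsto p_{s,t}(x,y)$ is measurable; for all $x\in[0,\infty)$ and $0\le s<t<T$ the function $y\mapsto p_{s,t}(x,y)$ is a probability density with respect to Lebesgue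 measure on $[0,\infty)$; and for all $x,z\in[0,\infty)$ and $0\le s<t<u<T$, $$p_{s,u}(x,z)=\int_0^\infty p_{s,t}(x,y)\,p_{t,u}(y,z)\,dy.$$
   Context: Let $T>0$ and let $(Z_t)_{0\le t\le T}$ be a time-homogeneous Markov process with state space $E=[0,\infty)$ (with its Borel $\sigma$-algebra) admitting transition densities $(p^Z_t)_{0<t\le T}$ with respect to Lebesgue measure, i.e. $\mathsf{P}(Z_t\in A\mid Z_s)=\int_A p^Z_{t-s}(Z_s,y)\,dy$ $\mathsf{P}$-a.s. for all Borel $A\subset[0,\infty)$, $0\le s<t\le T$; here each $p^Z_t(x,\cdot)$, $x\in[0,\infty)$, is a (nonnegative) probability density on $[0,\infty)$. Existence of a quotient limit as $\varepsilon\downarrow0$ includes that the denominators are nonzero for all sufficiently small $\varepsilon>0$. For $x,y\in[0,\infty)$ and $0\le s<t<T$ define, with $B(0,\varepsilon)=[0,\varepsilon)$ the open ball in $[0,\infty)$ around $b=0$, $$p_{s,t}(x,y):=p^Z_{t-s}(x,y)\lim_{\varepsilon\downarrow0}\frac{\int_{B(0,\varepsilon)}p^Z_{T-t}(y,z)\,dz}{\int_{B(0,\varepsilon)}p^Z_{T-s}(x,z)\,dz}$$ if the right hand side exists, and $p_{s,t}(x,y):=0$ otherwise. *)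

theory Defs
  imports "HOL-Probability.Probability"
begin

abbreviation half_line :: "real measure" where
  "half_line \<equiv> restrict_space borel {0..}"

definition prob_density_half_line :: "(real \<Rightarrow> real) \<Rightarrow> bool" where
  "prob_density_half_line f \<longleftrightarrow>
     f \<in> borel_measurable half_line \<and>
     (\<forall>y\<ge>0. 0 \<le> f y) \<and>
     (\<integral>\<^sup>+y\<in>{0..}. ennreal (f y) \<partial>lborel) = 1"

definition cond_prob_given ::
    "'a measure \<Rightarrow> 'a measure \<Rightarrow> 'a set \<Rightarrow> 'a \<Rightarrow> real" where
  "cond_prob_given M F B = real_cond_exp M F (indicat_real B)"

definition sigma_at :: "'a measure \<Rightarrow> (real \<Rightarrow> 'a \<Rightarrow> real) \<Rightarrow> real \<Rightarrow> 'a measure" where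
  "sigma_at M Z s = vimage_algebra (space M) (Z s) half_line"

definition past :: "'a measure \<Rightarrow> (real \<Rightarrow> 'a \<Rightarrow> real) \<Rightarrow> real \<Rightarrow> 'a measure" where
  "past M Z s =
     sigma (space M) {Z u -` A \<inter> space M | u A. 0 \<le> u \<and> u \<le> s \<and> A \<in> sets half_line}"

text \<open>The Markov property is taken with respect to the natural filtration, for the process
  indexed by \<open>[0, T]\<close>; values \<open>Z t\<close> at other times are irrelevant.\<close>

definition markov_process :: "'a measure \<Rightarrow> real \<Rightarrow> (real \<Rightarrow> 'a \<Rightarrow> real) \<Rightarrow> bool" where
  "markov_process M T Z \<longleftrightarrow>
     prob_space M \<and>
     (\<forall>t\<in>{0..T}. Z t \<in> measurable M half_line) \<and>
     (\<forall>s t. \<forall>A\<in>sets half_line. 0 \<le> s \<and> s < t \<and> t \<le> T \<longrightarrow>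
        (AE \<omega> in M. cond_prob_given M (past M Z s) (Z t -` A \<inter> space M) \<omega>
                   = cond_prob_given M (sigma_at M Z s) (Z t -` A \<inter> space M) \<omega>))"

text \<open>Time-homogeneity is the dependence of the transition density on \<open>t - s\<close> only. The
  arguments of \<open>p t x y\<close> that matter are \<open>0 < t \<le> T\<close> and \<open>x, y \<ge> 0\<close>.\<close>

definition transition_densities ::
    "'a measure \<Rightarrow> real \<Rightarrow> (real \<Rightarrow> 'a \<Rightarrow> real) \<Rightarrow> (real \<Rightarrow> real \<Rightarrow> real \<Rightarrow> real) \<Rightarrow> bool" where
  "transition_densities M T Z p \<longleftrightarrow>
     (\<forall>t x. 0 < t \<and> t \<le> T \<and> 0 \<le> x \<longrightarrow> prob_density_half_line (p t x)) \<and>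
     (\<forall>s t. \<forall>A\<in>sets half_line. 0 \<le> s \<and> s < t \<and> t \<le> T \<longrightarrow>
        (AE \<omega> in M. cond_prob_given M (sigma_at M Z s) (Z t -` A \<inter> space M) \<omega>
                   = (LINT y:A|lborel. p (t - s) (Z s \<omega>) y)))"

text \<open>Division by zero is zero in HOL, so the existence of a quotient limit has to demand
  explicitly that the denominators are eventually nonzero. Limits are finite.\<close>

definition quot_limit_exists :: "(real \<Rightarrow> real) \<Rightarrow> (real \<Rightarrow> real) \<Rightarrow> bool" where
  "quot_limit_exists f g \<longleftrightarrow>
     (\<forall>\<^sub>F \<epsilon> in at_right 0. g \<epsilon> \<noteq> 0) \<and>
     (\<exists>L. ((\<lambda>\<epsilon>. f \<epsilon> / g \<epsilon>) \<longlongrightarrow> L) (at_right 0))"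

definition quot_limit :: "(real \<Rightarrow> real) \<Rightarrow> (real \<Rightarrow> real) \<Rightarrow> real" where
  "quot_limit f g = Lim (at_right 0) (\<lambda>\<epsilon>. f \<epsilon> / g \<epsilon>)"

text \<open>The set \<open>{0..<\<epsilon>}\<close> is the open ball around the end point 0 in the half-line.\<close>

definition bridge_density ::
    "(real \<Rightarrow> real \<Rightarrow> real \<Rightarrow> real) \<Rightarrow> real \<Rightarrow> real \<Rightarrow> real \<Rightarrow> real \<Rightarrow> real \<Rightarrow> real" where
  "bridge_density p T s t x y =
     (let num = (\<lambda>\<epsilon>. LINT z:{0..<\<epsilon>}|lborel. p (T - t) y z);
          den = (\<lambda>\<epsilon>. LINT z:{0..<\<epsilon>}|lborel. p (T - s) x z)
      in if quot_limit_exists num den then p (t - s) x y * quot_limit num den else 0)"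

end

theory Submission
  imports Defs
begin

text \<open>
  Write \<open>h s t x y\<close> for the limit of \<open>p (T - t) y \<epsilon> / p (T - s) x \<epsilon>\<close> as \<open>\<epsilon>\<close> decreases to 0, so that
  the bridge density ought to be the Doob transform \<open>p (t - s) x y * h s t x y\<close>. Three observations
  prove everything.

  \<^item> Averaging numerator and denominator over \<open>[0, \<epsilon>)\<close> does not change the limit of a quotient of
    continuous functions with nonnegative denominator: an estimate \<open>\<bar>f - L * g\<bar> \<le> e * g\<close> near 0
    survives integration (\<open>quot_limit_average\<close>). Hence the bridge density, which is defined
    through averages, is the Doob transform above. It is measurable because \<open>h s t\<close> is the pointwise
    limit of a sequence of measurable functions.

  \<^item> By Kolmogorov-Chapman, \<open>y \<mapsto> p (t - s) x y * p (T - t) y \<epsilon> / p (T - s) x \<epsilon>\<close> has total mass 1 for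
    every small \<open>\<epsilon>\<close>. The uniform bound on the quotients dominates these functions by a multiple of the
    density \<open>p (t - s) x\<close>, so the mass is still 1 in the limit (\<open>h_transform_mass\<close>).

  \<^item> The quotients telescope, whence \<open>h s t x y * h t u y z = h s u x z\<close> (\<open>h_cocycle\<close>). The right-hand
    side does not depend on \<open>y\<close>, so it comes out of the integral, and the Kolmogorov-Chapman equation
    for the bridge reduces to the one for \<open>p\<close>.
\<close>

section \<open>Quotients of averages near the end point\<close>

lemma quot_limit_eqI:
  assumes "((\<lambda>\<epsilon>. f \<epsilon> / g \<epsilon>) \<longlongrightarrow> L) (at_right 0)"
  shows "quot_limit f g = L"
  unfolding quot_limit_def by (rule tendsto_Lim[OF _ assms]) simp

lemma quot_limit_tendsto:
  assumes "quot_limit_exists f g"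
  shows "((\<lambda>\<epsilon>. f \<epsilon> / g \<epsilon>) \<longlongrightarrow> quot_limit f g) (at_right 0)"
  using assms quot_limit_eqI unfolding quot_limit_exists_def by metis

lemma set_integrable_average:
  fixes f :: "real \<Rightarrow> real"
  assumes "continuous_on {0..} f"
  shows "set_integrable lborel {0..<\<epsilon>} f"
proof (rule set_integrable_subset)
  show "set_integrable lborel {0..\<epsilon>} f"
    unfolding set_integrable_def
    by (intro borel_integrable_compact continuous_on_subset[OF assms]) auto
qed auto

lemma average_pos:
  fixes g :: "real \<Rightarrow> real"
  assumes cont: "continuous_on {0..} g" and nonneg: "\<And>z. 0 \<le> z \<Longrightarrow> 0 \<le> g z"
    and \<epsilon>: "0 < \<epsilon>" and pos: "\<And>z. 0 < z \<Longrightarrow> z < \<epsilon> \<Longrightarrow> g z \<noteq> 0"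
  shows "0 < (LINT z:{0..<\<epsilon>}|lborel. g z)"
proof -
  let ?F = "\<lambda>z. indicator {0..<\<epsilon>} z *\<^sub>R g z"
  have int: "integrable lborel ?F"
    using set_integrable_average[OF cont] unfolding set_integrable_def .
  have nn: "AE z in lborel. 0 \<le> ?F z"
    using nonneg by (auto simp: indicator_def)
  have "(\<integral>z. ?F z \<partial>lborel) \<noteq> 0"
  proof
    assume "(\<integral>z. ?F z \<partial>lborel) = 0"
    then have "AE z in lborel. ?F z = 0"
      using integral_nonneg_eq_0_iff_AE[OF int nn] by simp
    then have "AE z in lborel. z \<notin> {0<..<\<epsilon>}"
      using pos by (auto simp: indicator_def elim!: eventually_mono split: if_splits)
    then have "emeasure lborel {0<..<\<epsilon>} = 0"
      by (subst (asm) AE_iff_measurable[where N="{0<..<\<epsilon>}"]) auto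
    then show False using \<epsilon> by simp
  qed
  moreover have "0 \<le> (\<integral>z. ?F z \<partial>lborel)"
    by (rule integral_nonneg_AE[OF nn])
  ultimately show ?thesis unfolding set_lebesgue_integral_def by linarith
qed

text \<open>
  This is an integrated form of L'Hopital's rule. If \<open>f / g\<close> is within \<open>e\<close> of \<open>L\<close> near 0 then
  \<open>\<bar>f - L * g\<bar> \<le> e * g\<close> there, and integrating over \<open>[0, \<epsilon>)\<close> gives the same bound for the integrals;
  strict positivity of the denominator integral then allows dividing again.
\<close>

lemma
  fixes f g :: "real \<Rightarrow> real"
  assumes f: "continuous_on {0..} f" and g: "continuous_on {0..} g"
    and nonneg: "\<And>z. 0 \<le> z \<Longrightarrow> 0 \<le> g z"
    and ex: "quot_limit_exists f g"
  shows quot_limit_exists_average: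
      "quot_limit_exists (\<lambda>\<epsilon>. LINT z:{0..<\<epsilon>}|lborel. f z) (\<lambda>\<epsilon>. LINT z:{0..<\<epsilon>}|lborel. g z)"
    and quot_limit_average:
      "quot_limit (\<lambda>\<epsilon>. LINT z:{0..<\<epsilon>}|lborel. f z) (\<lambda>\<epsilon>. LINT z:{0..<\<epsilon>}|lborel. g z)
         = quot_limit f g"
proof -
  define L where "L = quot_limit f g"
  let ?F = "\<lambda>\<epsilon>. LINT z:{0..<\<epsilon>}|lborel. f z" and ?G = "\<lambda>\<epsilon>. LINT z:{0..<\<epsilon>}|lborel. g z"
  have lim: "((\<lambda>\<epsilon>. f \<epsilon> / g \<epsilon>) \<longlongrightarrow> L) (at_right 0)"
    using quot_limit_tendsto[OF ex] unfolding L_def .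
  obtain d where d: "0 < d" "\<And>z. 0 < z \<Longrightarrow> z < d \<Longrightarrow> g z \<noteq> 0"
    using ex unfolding quot_limit_exists_def eventually_at_right_field by auto
  have G_pos: "0 < ?G \<epsilon>" if "0 < \<epsilon>" "\<epsilon> < d" for \<epsilon>
    using average_pos[OF g nonneg] that d by simp
  have nz: "\<forall>\<^sub>F \<epsilon> in at_right 0. ?G \<epsilon> \<noteq> 0"
    unfolding eventually_at_right_field using d G_pos by force
  have avg: "((\<lambda>\<epsilon>. ?F \<epsilon> / ?G \<epsilon>) \<longlongrightarrow> L) (at_right 0)"
  proof (rule tendstoI)
    fix e :: real assume "0 < e"
    then have "\<forall>\<^sub>F \<epsilon> in at_right 0. dist (f \<epsilon> / g \<epsilon>) L < e / 2"
      using tendstoD[OF lim, of "e / 2"] by simp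
    then obtain c where c: "0 < c" "\<And>z. 0 < z \<Longrightarrow> z < c \<Longrightarrow> \<bar>f z / g z - L\<bar> < e / 2"
      unfolding eventually_at_right_field dist_real_def by auto
    have bound: "f z \<le> (L + e / 2) * g z \<and> (L - e / 2) * g z \<le> f z" if z: "0 < z" "z < c" "z < d" for z
    proof -
      have gz: "0 < g z" using nonneg[of z] d(2)[of z] z by simp
      then have "\<bar>f z - L * g z\<bar> = \<bar>f z / g z - L\<bar> * g z"
        by (simp add: abs_mult_pos' field_simps abs_divide)
      also have "\<dots> \<le> e / 2 * g z"
        using c(2)[of z] z gz by (intro mult_right_mono) auto
      finally show ?thesis unfolding abs_le_iff by (simp add: distrib_right left_diff_distrib)
    qed
    have "dist (?F \<epsilon> / ?G \<epsilon>) L < e" if \<epsilon>: "0 < \<epsilon>" "\<epsilon> < min c d" for \<epsilon>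
    proof -
      have intf: "set_integrable lborel {0..<\<epsilon>} f" and intg: "set_integrable lborel {0..<\<epsilon>} g"
        using set_integrable_average f g by auto
      have intLg: "set_integrable lborel {0..<\<epsilon>} (\<lambda>z. a * g z)" for a
        using intg by simp
      \<comment> \<open>Nothing is known about \<open>f / g\<close> at the end point 0 itself, which is a null set.\<close>
      have AE0: "AE z in lborel. z \<noteq> (0::real)"
        by (rule AE_lborel_singleton)
      have upper: "?F \<epsilon> \<le> (LINT z:{0..<\<epsilon>}|lborel. (L + e / 2) * g z)"
      proof (rule set_integral_mono_AE[OF intf intLg])
        show "AE z\<in>{0..<\<epsilon>} in lborel. f z \<le> (L + e / 2) * g z"
          using AE0
        proof eventually_elim
          case (elim z)
          then show ?case using bound[of z] \<epsilon> by auto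
        qed
      qed
      have lower: "(LINT z:{0..<\<epsilon>}|lborel. (L - e / 2) * g z) \<le> ?F \<epsilon>"
      proof (rule set_integral_mono_AE[OF intLg intf])
        show "AE z\<in>{0..<\<epsilon>} in lborel. (L - e / 2) * g z \<le> f z"
          using AE0
        proof eventually_elim
          case (elim z)
          then show ?case using bound[of z] \<epsilon> by auto
        qed
      qed
      have G: "0 < ?G \<epsilon>" using G_pos \<epsilon> by simp
      have "L - e / 2 \<le> ?F \<epsilon> / ?G \<epsilon>" "?F \<epsilon> / ?G \<epsilon> \<le> L + e / 2"
        using upper lower G by (simp_all add: pos_le_divide_eq pos_divide_le_eq)
      then show ?thesis using \<open>0 < e\<close> unfolding dist_real_def by (simp add: abs_less_iff)
    qed
    then show "\<forall>\<^sub>F \<epsilon> in at_right 0. dist (?F \<epsilon> / ?G \<epsilon>) L < e"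
      unfolding eventually_at_right_field using c(1) d(1)
      by (intro exI[of _ "min c d"]) auto
  qed
  show "quot_limit_exists ?F ?G"
    unfolding quot_limit_exists_def using nz avg by blast
  show "quot_limit ?F ?G = quot_limit f g"
    using quot_limit_eqI[OF avg] unfolding L_def .
qed

section \<open>The Doob transform of a transition density pinned at the end point\<close>

text \<open>
  The argument is purely analytic: it concerns a semigroup of densities, of which a Markov process is
  one source. The last two assumptions describe the pinning at 0. Convergence provides the harmonic
  function of the Doob transform; boundedness, uniform in the starting point of the numerator,
  prevents mass from escaping in the limit.
\<close>

locale pinned_density =
  fixes T :: real and p :: "real \<Rightarrow> real \<Rightarrow> real \<Rightarrow> real"
  assumes density: "\<And>t x. 0 < t \<Longrightarrow> t \<le> T \<Longrightarrow> 0 \<le> x \<Longrightarrow> prob_density_half_line (p t x)"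
    and continuous: "\<And>t. 0 < t \<Longrightarrow> t \<le> T \<Longrightarrow> continuous_on ({0..} \<times> {0..}) (\<lambda>(x, y). p t x y)"
    and kolmogorov_chapman:
      "\<And>s t x z. 0 < s \<Longrightarrow> 0 < t \<Longrightarrow> s + t \<le> T \<Longrightarrow> 0 \<le> x \<Longrightarrow> 0 \<le> z \<Longrightarrow>
         ennreal (p (s + t) x z) = (\<integral>\<^sup>+y\<in>{0..}. ennreal (p s x y * p t y z) \<partial>lborel)"
    and quotients_converge:
      "\<And>s t x y. 0 \<le> s \<Longrightarrow> s < t \<Longrightarrow> t < T \<Longrightarrow> 0 \<le> x \<Longrightarrow> 0 \<le> y \<Longrightarrow>
         quot_limit_exists (\<lambda>\<epsilon>. p (T - t) y \<epsilon>) (\<lambda>\<epsilon>. p (T - s) x \<epsilon>)"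
    and quotients_bounded:
      "\<And>s t x. 0 \<le> s \<Longrightarrow> s < t \<Longrightarrow> t < T \<Longrightarrow> 0 \<le> x \<Longrightarrow>
         \<exists>\<delta>>0. (SUP y\<in>{0..}. SUP \<epsilon>\<in>{0<..<\<delta>}. ennreal (p (T - t) y \<epsilon> / p (T - s) x \<epsilon>)) < \<infinity>"
begin

definition h :: "real \<Rightarrow> real \<Rightarrow> real \<Rightarrow> real \<Rightarrow> real" where
  "h s t x y = quot_limit (\<lambda>\<epsilon>. p (T - t) y \<epsilon>) (\<lambda>\<epsilon>. p (T - s) x \<epsilon>)"

lemma nonneg: "0 \<le> p t x y" if "0 < t" "t \<le> T" "0 \<le> x" "0 \<le> y"
  using density[OF that(1-3)] that(4) unfolding prob_density_half_line_def by blast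

lemma continuous_target: "continuous_on {0..} (p t x)" if "0 < t" "t \<le> T" "0 \<le> x"
proof -
  have "continuous_on {0..} ((\<lambda>(x, y). p t x y) \<circ> (\<lambda>y. (x, y)))"
    using that
    by (intro continuous_on_compose continuous_intros continuous_on_subset[OF continuous]) auto
  then show ?thesis by (simp add: o_def)
qed

lemma h_tendsto:
  assumes "0 \<le> s" "s < t" "t < T" "0 \<le> x" "0 \<le> y"
  shows "((\<lambda>\<epsilon>. p (T - t) y \<epsilon> / p (T - s) x \<epsilon>) \<longlongrightarrow> h s t x y) (at_right 0)"
  using quot_limit_tendsto[OF quotients_converge[OF assms]] unfolding h_def .

lemma denominator_pos:
  assumes "0 \<le> s" "s < T" "0 \<le> x"
  shows "\<forall>\<^sub>F \<epsilon> in at_right 0. 0 < p (T - s) x \<epsilon>"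
proof -
  \<comment> \<open>Any later time serves as numerator; only the denominator is of interest.\<close>
  have "\<forall>\<^sub>F \<epsilon> in at_right 0. p (T - s) x \<epsilon> \<noteq> 0"
    using quotients_converge[of s "(s + T) / 2" x 0] assms
    unfolding quot_limit_exists_def by auto
  with eventually_at_right_less show ?thesis
  proof eventually_elim
    case (elim \<epsilon>)
    then show ?case using nonneg[of "T - s" x \<epsilon>] assms by auto
  qed
qed

lemma h_nonneg:
  assumes "0 \<le> s" "s < t" "t < T" "0 \<le> x" "0 \<le> y"
  shows "0 \<le> h s t x y"
proof (rule tendsto_lowerbound[OF h_tendsto[OF assms]])
  show "\<forall>\<^sub>F \<epsilon> in at_right 0. 0 \<le> p (T - t) y \<epsilon> / p (T - s) x \<epsilon>"
    using eventually_at_right_less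
  proof eventually_elim
    case (elim \<epsilon>)
    then show ?case using assms by (intro divide_nonneg_nonneg nonneg) auto
  qed
qed simp

text \<open>
  The intermediate factor \<open>p (T - t) y \<epsilon>\<close> cancels in the product of the two quotients, because it is
  nonzero for small \<open>\<epsilon>\<close>.
\<close>

lemma h_cocycle:
  assumes "0 \<le> s" "s < t" "t < u" "u < T" "0 \<le> x" "0 \<le> y" "0 \<le> z"
  shows "h s t x y * h t u y z = h s u x z"
proof (rule tendsto_unique[OF _ _ h_tendsto])
  have lim: "((\<lambda>\<epsilon>. p (T - t) y \<epsilon> / p (T - s) x \<epsilon> * (p (T - u) z \<epsilon> / p (T - t) y \<epsilon>))
      \<longlongrightarrow> h s t x y * h t u y z) (at_right 0)"
    using assms by (intro tendsto_mult h_tendsto) auto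
  have "\<forall>\<^sub>F \<epsilon> in at_right 0. 0 < p (T - t) y \<epsilon>"
    using assms by (intro denominator_pos) auto
  then have "\<forall>\<^sub>F \<epsilon> in at_right 0.
      p (T - t) y \<epsilon> / p (T - s) x \<epsilon> * (p (T - u) z \<epsilon> / p (T - t) y \<epsilon>) = p (T - u) z \<epsilon> / p (T - s) x \<epsilon>"
    by eventually_elim simp
  from Lim_transform_eventually[OF lim this]
  show "((\<lambda>\<epsilon>. p (T - u) z \<epsilon> / p (T - s) x \<epsilon>) \<longlongrightarrow> h s t x y * h t u y z) (at_right 0)" .
qed (use assms in auto)

lemma bridge_density_eq:
  assumes "0 \<le> s" "s < t" "t < T" "0 \<le> x" "0 \<le> y"
  shows "bridge_density p T s t x y = p (t - s) x y * h s t x y"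
proof -
  note avg = continuous_target[of "T - t" y] continuous_target[of "T - s" x]
    nonneg[of "T - s" x] quotients_converge[OF assms]
  have "quot_limit_exists (\<lambda>\<epsilon>. LINT z:{0..<\<epsilon>}|lborel. p (T - t) y z)
      (\<lambda>\<epsilon>. LINT z:{0..<\<epsilon>}|lborel. p (T - s) x z)"
    using assms by (intro quot_limit_exists_average avg) auto
  moreover have "quot_limit (\<lambda>\<epsilon>. LINT z:{0..<\<epsilon>}|lborel. p (T - t) y z)
      (\<lambda>\<epsilon>. LINT z:{0..<\<epsilon>}|lborel. p (T - s) x z) = h s t x y"
    unfolding h_def using assms by (intro quot_limit_average avg) auto
  ultimately show ?thesis unfolding bridge_density_def Let_def by simp
qed

lemma bridge_density_nonneg:
  assumes "0 \<le> s" "s < t" "t < T" "0 \<le> x" "0 \<le> y"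
  shows "0 \<le> bridge_density p T s t x y"
  using assms by (simp add: bridge_density_eq nonneg h_nonneg)

section \<open>Measurability\<close>

text \<open>
  Joint continuity gives joint measurability, stated for composed arguments so that either variable
  can be frozen at a constant or follow a coordinate of a product.
\<close>

lemma measurable_p:
  assumes "0 < t" "t \<le> T"
    and f: "f \<in> measurable N half_line" and g: "g \<in> measurable N half_line"
  shows "(\<lambda>w. p t (f w) (g w)) \<in> borel_measurable N"
proof -
  have p: "(\<lambda>(x, y). p t x y) \<in> borel_measurable (restrict_space borel ({0..} \<times> {0..}))"
    using assms by (intro borel_measurable_continuous_on_restrict continuous)
  have fb: "f \<in> borel_measurable N" "f \<in> space N \<rightarrow> {0..}"
    and gb: "g \<in> borel_measurable N" "g \<in> space N \<rightarrow> {0..}"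
    using f g by (auto simp: measurable_restrict_space2_iff)
  have "(\<lambda>w. (f w, g w)) \<in> measurable N (restrict_space borel ({0..} \<times> {0..}))"
    using fb gb by (intro measurable_restrict_space2) auto
  from measurable_compose[OF this p] show ?thesis by simp
qed

lemma measurable_bridge_density:
  assumes "0 \<le> s" "s < t" "t < T"
  shows "(\<lambda>(x, y). bridge_density p T s t x y) \<in> borel_measurable (half_line \<Otimes>\<^sub>M half_line)"
proof (rule borel_measurable_LIMSEQ_real)
  define \<epsilon> :: "nat \<Rightarrow> real" where "\<epsilon> n = 1 / real (Suc n)" for n
  have \<epsilon>: "filterlim \<epsilon> (at_right 0) sequentially"
    unfolding \<epsilon>_def using LIMSEQ_inverse_real_of_nat
    by (intro tendsto_imp_filterlim_at_right) (simp_all add: inverse_eq_divide)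
  let ?u = "\<lambda>n w. p (t - s) (fst w) (snd w) *
    (p (T - t) (snd w) (\<epsilon> n) / p (T - s) (fst w) (\<epsilon> n))"
  show "(\<lambda>n. ?u n w) \<longlonglongrightarrow> (case w of (x, y) \<Rightarrow> bridge_density p T s t x y)"
    if "w \<in> space (half_line \<Otimes>\<^sub>M half_line)" for w
  proof -
    have "w \<in> {0..} \<times> {0..}"
      using that by (simp add: space_pair_measure)
    then obtain x y where w: "w = (x, y)" "0 \<le> x" "0 \<le> y"
      by auto
    show ?thesis
      unfolding w(1) prod.case fst_conv snd_conv bridge_density_eq[OF assms w(2,3)]
      by (intro tendsto_mult tendsto_const filterlim_compose[OF h_tendsto[OF assms w(2,3)] \<epsilon>])
  qed
  show "?u n \<in> borel_measurable (half_line \<Otimes>\<^sub>M half_line)" for n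
  proof -
    have [measurable]: "(\<lambda>_. \<epsilon> n) \<in> measurable (half_line \<Otimes>\<^sub>M half_line) half_line"
      by (rule measurable_const) (simp add: \<epsilon>_def)
    show ?thesis
      using assms by (intro borel_measurable_times borel_measurable_divide measurable_p) auto
  qed
qed

section \<open>Total mass and the Kolmogorov-Chapman equation of the bridge\<close>

text \<open>
  Dominated convergence along a sequence of \<open>\<epsilon>\<close> decreasing to 0: Kolmogorov-Chapman makes each approximating mass exactly 1,
  and the uniform bound \<open>C\<close> on the quotients makes \<open>C * p (t - s) x\<close> an integrable majorant.
\<close>

lemma h_transform_mass:
  assumes st: "0 \<le> s" "s < t" "t < T" and x: "0 \<le> x"
  shows "(\<integral>\<^sup>+y\<in>{0..}. ennreal (p (t - s) x y * h s t x y) \<partial>lborel) = 1"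
proof -
  let ?N = "restrict_space lborel {0::real..}"
  let ?r = "\<lambda>\<epsilon> y. p (T - t) y \<epsilon> / p (T - s) x \<epsilon>"
  obtain \<delta> where \<delta>: "0 < \<delta>" "(SUP y\<in>{0..}. SUP \<epsilon>\<in>{0<..<\<delta>}. ennreal (?r \<epsilon> y)) < \<infinity>"
    using quotients_bounded[OF st x] by auto
  obtain C where C: "0 \<le> C" "(SUP y\<in>{0..}. SUP \<epsilon>\<in>{0<..<\<delta>}. ennreal (?r \<epsilon> y)) = ennreal C"
    using \<delta>(2) by (cases "SUP y\<in>{0..}. SUP \<epsilon>\<in>{0<..<\<delta>}. ennreal (?r \<epsilon> y)") auto
  have bound: "?r \<epsilon> y \<le> C" if "0 < \<epsilon>" "\<epsilon> < \<delta>" "0 \<le> y" for \<epsilon> y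
  proof -
    have "ennreal (?r \<epsilon> y) \<le> (SUP y\<in>{0..}. SUP \<epsilon>\<in>{0<..<\<delta>}. ennreal (?r \<epsilon> y))"
      using that by (intro SUP_upper2[of y] SUP_upper2[of \<epsilon>]) auto
    then show ?thesis using C by (simp add: ennreal_le_iff)
  qed
  obtain d where d: "0 < d" "\<And>\<epsilon>. 0 < \<epsilon> \<Longrightarrow> \<epsilon> < d \<Longrightarrow> 0 < p (T - s) x \<epsilon>"
    using denominator_pos[of s x] st x unfolding eventually_at_right_field by auto
  \<comment> \<open>Starting the sequence below \<open>\<delta>\<close> and \<open>d\<close> makes bound and positivity hold for every \<open>n\<close>.\<close>
  define m where "m = min \<delta> d"
  have m: "0 < m" "m \<le> \<delta>" "m \<le> d" using \<delta>(1) d(1) unfolding m_def by auto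
  define \<epsilon> :: "nat \<Rightarrow> real" where "\<epsilon> n = m / real (n + 2)" for n
  have \<epsilon>_range: "0 < \<epsilon> n" "\<epsilon> n < m" for n
    using m(1) by (simp_all add: \<epsilon>_def pos_divide_less_eq)
  have "\<epsilon> \<longlonglongrightarrow> 0"
    unfolding \<epsilon>_def by real_asymp
  then have \<epsilon>: "filterlim \<epsilon> (at_right 0) sequentially"
    by (rule tendsto_imp_filterlim_at_right) (simp add: \<epsilon>_range(1))
  have id: "(\<lambda>y. y) \<in> measurable ?N half_line"
    by (intro measurable_restrict_space3) auto
  have const: "(\<lambda>_. c) \<in> measurable ?N half_line" if "0 \<le> c" for c
    using that by (intro measurable_const) simp
  have meas_p: "p (t - s) x \<in> borel_measurable ?N"
    using st x by (intro measurable_p[OF _ _ const id]) auto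
  have meas_r: "?r (\<epsilon> n) \<in> borel_measurable ?N" for n
    using st less_imp_le[OF \<epsilon>_range(1)]
    by (intro borel_measurable_divide borel_measurable_const measurable_p[OF _ _ id const]) auto
  have meas_pr: "(\<lambda>y. p (t - s) x y * ?r (\<epsilon> n) y) \<in> borel_measurable ?N" for n
    by (rule borel_measurable_times[OF meas_p meas_r])
  have lim: "(\<lambda>n. p (t - s) x y * ?r (\<epsilon> n) y) \<longlonglongrightarrow> p (t - s) x y * h s t x y"
    if "y \<in> space ?N" for y
  proof -
    have "0 \<le> y" using that by (simp add: space_restrict_space)
    from tendsto_mult[OF tendsto_const filterlim_compose[OF h_tendsto[OF st x this] \<epsilon>]]
    show ?thesis .
  qed
  have mass: "(\<integral>\<^sup>+y. ennreal (p (t - s) x y * ?r (\<epsilon> n) y) \<partial>?N) = 1" for n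
  proof -
    let ?a = "p (T - s) x (\<epsilon> n)"
    have a: "0 < ?a" using d(2) \<epsilon>_range[of n] m by auto
    have "(\<integral>\<^sup>+y. ennreal (p (t - s) x y * ?r (\<epsilon> n) y) \<partial>?N)
        = (\<integral>\<^sup>+y. ennreal (p (t - s) x y * p (T - t) y (\<epsilon> n)) / ennreal ?a \<partial>?N)"
    proof (rule nn_integral_cong)
      fix y assume "y \<in> space ?N"
      then have "0 \<le> p (t - s) x y * p (T - t) y (\<epsilon> n)"
        using st x less_imp_le[OF \<epsilon>_range(1)] by (intro mult_nonneg_nonneg nonneg) (auto simp: space_restrict_space)
      then show "ennreal (p (t - s) x y * ?r (\<epsilon> n) y)
          = ennreal (p (t - s) x y * p (T - t) y (\<epsilon> n)) / ennreal ?a"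
        using a by (simp add: divide_ennreal)
    qed
    also have "\<dots> = (\<integral>\<^sup>+y. ennreal (p (t - s) x y * p (T - t) y (\<epsilon> n)) \<partial>?N) / ennreal ?a"
      using st less_imp_le[OF \<epsilon>_range(1)] meas_p
      by (intro nn_integral_divide measurable_compose[OF _ measurable_ennreal]
            borel_measurable_times measurable_p[OF _ _ id const]) auto
    also have "(\<integral>\<^sup>+y. ennreal (p (t - s) x y * p (T - t) y (\<epsilon> n)) \<partial>?N) = ennreal ?a"
      using kolmogorov_chapman[of "t - s" "T - t" x "\<epsilon> n"] st x less_imp_le[OF \<epsilon>_range(1)]
      by (simp add: nn_integral_restrict_space)
    finally show ?thesis using a by (simp add: ennreal_divide_self)
  qed
  have "(\<lambda>n. \<integral>\<^sup>+y. ennreal (p (t - s) x y * ?r (\<epsilon> n) y) \<partial>?N)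
      \<longlonglongrightarrow> (\<integral>\<^sup>+y. ennreal (p (t - s) x y * h s t x y) \<partial>?N)"
  proof (rule nn_integral_dominated_convergence[where w="\<lambda>y. ennreal C * ennreal (p (t - s) x y)"])
    show "(\<lambda>y. ennreal (p (t - s) x y * ?r (\<epsilon> n) y)) \<in> borel_measurable ?N" for n
      by (rule measurable_compose[OF meas_pr measurable_ennreal])
    show "(\<lambda>y. ennreal C * ennreal (p (t - s) x y)) \<in> borel_measurable ?N"
      by (intro borel_measurable_times_ennreal borel_measurable_const
            measurable_compose[OF meas_p measurable_ennreal])
    show "(\<lambda>y. ennreal (p (t - s) x y * h s t x y)) \<in> borel_measurable ?N"
      by (rule measurable_compose[OF borel_measurable_LIMSEQ_real[OF lim meas_pr] measurable_ennreal])
    show "AE y in ?N. ennreal (p (t - s) x y * ?r (\<epsilon> n) y) \<le> ennreal C * ennreal (p (t - s) x y)" for n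
    proof (rule AE_I2)
      fix y assume "y \<in> space ?N"
      then have y: "0 \<le> y" by (simp add: space_restrict_space)
      have p: "0 \<le> p (t - s) x y" using st x y by (intro nonneg) auto
      have "?r (\<epsilon> n) y \<le> C" using bound y \<epsilon>_range[of n] m by auto
      then have "p (t - s) x y * ?r (\<epsilon> n) y \<le> C * p (t - s) x y"
        unfolding mult.commute[of "p (t - s) x y"] by (rule mult_right_mono[OF _ p])
      then show "ennreal (p (t - s) x y * ?r (\<epsilon> n) y) \<le> ennreal C * ennreal (p (t - s) x y)"
        using C(1) p by (simp add: ennreal_mult[symmetric] ennreal_leI)
    qed
    have "(\<integral>\<^sup>+y. ennreal (p (t - s) x y) \<partial>?N) = 1"
      using density[of "t - s" x] st x
      by (simp add: prob_density_half_line_def nn_integral_restrict_space)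
    then show "(\<integral>\<^sup>+y. ennreal C * ennreal (p (t - s) x y) \<partial>?N) < \<infinity>"
      using meas_p by (subst nn_integral_cmult) auto
    show "AE y in ?N. (\<lambda>n. ennreal (p (t - s) x y * ?r (\<epsilon> n) y))
        \<longlonglongrightarrow> ennreal (p (t - s) x y * h s t x y)"
      by (intro AE_I2 tendsto_ennrealI lim)
  qed
  then have "(\<integral>\<^sup>+y. ennreal (p (t - s) x y * h s t x y) \<partial>?N) = 1"
    unfolding mass by (rule LIMSEQ_unique[OF _ tendsto_const])
  then show ?thesis by (simp add: nn_integral_restrict_space)
qed

lemma prob_density_bridge_density:
  assumes "0 \<le> s" "s < t" "t < T" "0 \<le> x"
  shows "prob_density_half_line (bridge_density p T s t x)"
  unfolding prob_density_half_line_def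
proof (intro conjI allI impI)
  have "(\<lambda>y. (x, y)) \<in> measurable half_line (half_line \<Otimes>\<^sub>M half_line)"
    using assms by (intro measurable_Pair1') simp
  from measurable_compose[OF this measurable_bridge_density]
  show "bridge_density p T s t x \<in> borel_measurable half_line"
    using assms by simp
  have "(\<integral>\<^sup>+y\<in>{0..}. ennreal (bridge_density p T s t x y) \<partial>lborel)
      = (\<integral>\<^sup>+y\<in>{0..}. ennreal (p (t - s) x y * h s t x y) \<partial>lborel)"
    using assms by (intro nn_integral_cong) (auto simp: bridge_density_eq indicator_def)
  then show "(\<integral>\<^sup>+y\<in>{0..}. ennreal (bridge_density p T s t x y) \<partial>lborel) = 1"
    using h_transform_mass assms by simp
qed (use assms bridge_density_nonneg in auto)

lemma bridge_kolmogorov_chapman: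
  assumes "0 \<le> s" "s < t" "t < u" "u < T" and x: "0 \<le> x" and z: "0 \<le> z"
  shows "ennreal (bridge_density p T s u x z) =
    (\<integral>\<^sup>+y\<in>{0..}. ennreal (bridge_density p T s t x y * bridge_density p T t u y z) \<partial>lborel)"
proof -
  let ?N = "restrict_space lborel {0::real..}"
  have id: "(\<lambda>y. y) \<in> measurable ?N half_line"
    by (intro measurable_restrict_space3) auto
  have const: "(\<lambda>_. c) \<in> measurable ?N half_line" if "0 \<le> c" for c
    using that by (intro measurable_const) simp
  have h: "0 \<le> h s u x z" using assms by (intro h_nonneg) auto
  have "(\<integral>\<^sup>+y. ennreal (bridge_density p T s t x y * bridge_density p T t u y z) \<partial>?N)
      = (\<integral>\<^sup>+y. ennreal (h s u x z) * ennreal (p (t - s) x y * p (u - t) y z) \<partial>?N)"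
  proof (rule nn_integral_cong)
    fix y assume "y \<in> space ?N"
    then have y: "0 \<le> y" by (simp add: space_restrict_space)
    have "bridge_density p T s t x y * bridge_density p T t u y z
        = (h s t x y * h t u y z) * (p (t - s) x y * p (u - t) y z)"
      using assms y by (simp add: bridge_density_eq)
    also have "\<dots> = h s u x z * (p (t - s) x y * p (u - t) y z)"
      using assms y by (simp add: h_cocycle)
    finally show "ennreal (bridge_density p T s t x y * bridge_density p T t u y z)
        = ennreal (h s u x z) * ennreal (p (t - s) x y * p (u - t) y z)"
      using h assms y by (simp add: ennreal_mult nonneg)
  qed
  also have "\<dots> = ennreal (h s u x z) * (\<integral>\<^sup>+y. ennreal (p (t - s) x y * p (u - t) y z) \<partial>?N)"
    using assms
    by (intro nn_integral_cmult measurable_compose[OF _ measurable_ennreal] borel_measurable_times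
          measurable_p[OF _ _ id const] measurable_p[OF _ _ const id]) auto
  also have "(\<integral>\<^sup>+y. ennreal (p (t - s) x y * p (u - t) y z) \<partial>?N) = ennreal (p (u - s) x z)"
    using kolmogorov_chapman[of "t - s" "u - t" x z] assms
    by (simp add: nn_integral_restrict_space)
  also have "ennreal (h s u x z) * ennreal (p (u - s) x z) = ennreal (bridge_density p T s u x z)"
    using h assms by (simp add: bridge_density_eq ennreal_mult nonneg mult.commute)
  finally show ?thesis by (simp add: nn_integral_restrict_space)
qed

end

section \<open>The bridge densities\<close>

theorem lemma2p6:
  fixes M :: "'a measure"
    and Z :: "real \<Rightarrow> 'a \<Rightarrow> real"
    and T :: real
    and p :: "real \<Rightarrow> real \<Rightarrow> real \<Rightarrow> real"
  assumes "0 < T"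
    and "markov_process M T Z"
    and "transition_densities M T Z p"
    and "\<And>t. 0 < t \<Longrightarrow> t \<le> T \<Longrightarrow> continuous_on ({0..} \<times> {0..}) (\<lambda>(x, y). p t x y)"
    and "\<And>s t x z. 0 < s \<Longrightarrow> 0 < t \<Longrightarrow> s + t \<le> T \<Longrightarrow> 0 \<le> x \<Longrightarrow> 0 \<le> z \<Longrightarrow>
           ennreal (p (s + t) x z) = (\<integral>\<^sup>+y\<in>{0..}. ennreal (p s x y * p t y z) \<partial>lborel)"
    and "\<And>s t x y. 0 \<le> s \<Longrightarrow> s < t \<Longrightarrow> t < T \<Longrightarrow> 0 \<le> x \<Longrightarrow> 0 \<le> y \<Longrightarrow>
           quot_limit_exists (\<lambda>\<epsilon>. p (T - t) y \<epsilon>) (\<lambda>\<epsilon>. p (T - s) x \<epsilon>)"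
    and "\<And>s t x. 0 \<le> s \<Longrightarrow> s < t \<Longrightarrow> t < T \<Longrightarrow> 0 \<le> x \<Longrightarrow>
           \<exists>\<delta>>0. (SUP y\<in>{0..}. SUP \<epsilon>\<in>{0<..<\<delta>}. ennreal (p (T - t) y \<epsilon> / p (T - s) x \<epsilon>)) < \<infinity>"
  shows "(\<forall>s t x y. 0 \<le> s \<and> s < t \<and> t < T \<and> 0 \<le> x \<and> 0 \<le> y \<longrightarrow>
            bridge_density p T s t x y =
              p (t - s) x y * quot_limit (\<lambda>\<epsilon>. p (T - t) y \<epsilon>) (\<lambda>\<epsilon>. p (T - s) x \<epsilon>))
       \<and> (\<forall>s t. 0 \<le> s \<and> s < t \<and> t < T \<longrightarrow>
            (\<lambda>(x, y). bridge_density p T s t x y) \<in> borel_measurable (half_line \<Otimes>\<^sub>M half_line))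
       \<and> (\<forall>s t x. 0 \<le> s \<and> s < t \<and> t < T \<and> 0 \<le> x \<longrightarrow>
            prob_density_half_line (bridge_density p T s t x))
       \<and> (\<forall>s t u x z. 0 \<le> s \<and> s < t \<and> t < u \<and> u < T \<and> 0 \<le> x \<and> 0 \<le> z \<longrightarrow>
            ennreal (bridge_density p T s u x z) =
              (\<integral>\<^sup>+y\<in>{0..}. ennreal (bridge_density p T s t x y * bridge_density p T t u y z) \<partial>lborel))"
proof -
  interpret pinned_density T p
  proof
    show "prob_density_half_line (p t x)" if "0 < t" "t \<le> T" "0 \<le> x" for t x
      using assms(3) that unfolding transition_densities_def by blast
  qed (fact assms(4) assms(5) assms(6) assms(7))+
  show ?thesis
    using bridge_density_eq measurable_bridge_density prob_density_bridge_density
      bridge_kolmogorov_chapman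
    unfolding h_def by blast
qed

end
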